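(* Let $m\geqslant 2$, $n=2^m-2$, and let $L^*$ be the Lie algebra and $G\leqslant \mathrm{GL}(L^* )$ the group defined in the context. Then the element $1+\mathrm{ad}(x)$ is a left 3-Engel element in $G$, and the normal closure $\langle 1+\mathrm{ad}(x)\rangle^G$ of $1+\mathrm{ad}(x)$ in $G$ is not nilpotent.
   Context: Let $m\geqslant 2$ be an integer, $n=2^m-2$, and $\mathbb{F}$ the field with two elements. Let $L$ be the Lie algebra over $\mathbb{F}$ with basis $v(0),\dots,v(n-1),w,x$ and bilinear product determined by $v(i)\cdot v(j)=\binom{j+1}{n-i}v(i\oplus j)$ for $0\leqslant i,j\leqslant n-1$ (binomials modulo 2; $i\oplus j\in\{0,\dots,n-2\}$ is congruent to $i+j$ modulo $n-1$); $v(i)\cdot w=w\cdot v(i)=v(i+1)$ for $0\leqslant i\leqslant n-2$; $v(n-1)\cdot w=w\cdot v(n-1)=w$; $v(i)\cdot x=x\cdot v(i)=0$; $w\cdot x=x\cdot w=v(0)$; $w\cdot w=x\cdot x=0$. Let $W=\mathbb{F}v(0)+\dots+\mathbb{F}v(n-1)+\mathbb{F}w$. For subsets $A,B$ of $\mathbb{N}=\{0,1,2,\dots\}$ put $A\sqcup B=A\cup B$ if $A\cap B=\emptyset$, and $A\sqcup B=\emptyset$ otherwise. For each non-empty $A\subseteq\mathbb{N}$ let $W_A=\{z_A: z\in W\}$ be a copy of the vector space $W$, and put $z_\emptyset=0$. Let $W^*=\bigoplus_{\emptyset\neq A\subseteq\mathbb{N}}W_A$ with the Lie product given by bilinear extension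 of $z_A\cdot t_B=(z\cdot t)_{A\sqcup B}$ for $z,t\in W$ and non-empty $A,B$. Let $L^*=W^*\oplus\mathbb{F}x$ be the semidirect product Lie algebra with $z_A\cdot x=x\cdot z_A=(z\cdot x)_A$ and $x\cdot x=0$. For $y\in L^*$, $\mathrm{ad}(y)$ is the linear operator $z\mapsto z\cdot y$ on $L^*$; operators act on the right and products of operators are read from left to right. Put $\mathcal{V}_i=\langle 1+\mathrm{ad}(v(i)_A): A\subseteq\mathbb{N}\rangle$ for $0\leqslant i\leqslant n-1$, $\mathcal{W}=\langle 1+\mathrm{ad}(w_A): A\subseteq\mathbb{N}\rangle$, and $G=\langle 1+\mathrm{ad}(x),\mathcal{V}_0,\dots,\mathcal{V}_{n-1},\mathcal{W}\rangle\leqslant\mathrm{GL}(L^* )$. Group commutators are $[a,b]=a^{-1}b^{-1}ab$ and are left normed. An element $a\in G$ is a left 3-Engel element in $G$ if $[[[g,a],a],a]=1$ for all $g\in G$. *)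

theory Defs
  imports "HOL-Algebra.Algebra" "HOL-Library.Poly_Mapping" "HOL-Library.Product_Plus" "HOL-Library.Z2"
begin

section \<open>The Lie algebra \<open>L\<close> and its subspace \<open>W\<close>\<close>

text \<open>
  The field with two elements is the type \<^typ>\<open>bit\<close>, and finitely supported functions
  \<open>'b \<Rightarrow>\<^sub>0 bit\<close> are the vector space over it with basis \<open>'b\<close>. The following is the only possible
  scalar multiplication by \<^typ>\<open>bit\<close> on an abelian group.
\<close>

definition smul :: "bit \<Rightarrow> 'a::zero \<Rightarrow> 'a" where
  "smul c a = (if c = 0 then 0 else a)"

text \<open>
  The names of the basis vectors do not depend on \<open>n\<close>. Only \<open>BV i\<close> with \<open>i < n\<close>
  belongs to the algebra; the spaces below are carved out by explicit carriers.
\<close>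

datatype lbasis = BV nat | BW | BX

type_synonym lvec = "lbasis \<Rightarrow>\<^sub>0 bit"

abbreviation vL :: "nat \<Rightarrow> lvec" where "vL i \<equiv> Poly_Mapping.single (BV i) 1"
abbreviation wL :: lvec where "wL \<equiv> Poly_Mapping.single BW 1"
abbreviation xL :: lvec where "xL \<equiv> Poly_Mapping.single BX 1"

text \<open>For \<open>n \<ge> 2\<close>, \<open>(i + j) mod (n - 1)\<close> is the \<open>i \<oplus> j\<close> of the definition of the product.\<close>

fun basis_prod :: "nat \<Rightarrow> lbasis \<Rightarrow> lbasis \<Rightarrow> lvec" where
  "basis_prod n (BV i) (BV j) = smul (of_nat ((j + 1) choose (n - i))) (vL ((i + j) mod (n - 1)))"
| "basis_prod n (BV i) BW = (if i = n - 1 then wL else vL (i + 1))"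
| "basis_prod n BW (BV i) = (if i = n - 1 then wL else vL (i + 1))"
| "basis_prod n (BV i) BX = 0"
| "basis_prod n BX (BV i) = 0"
| "basis_prod n BW BX = vL 0"
| "basis_prod n BX BW = vL 0"
| "basis_prod n BW BW = 0"
| "basis_prod n BX BX = 0"

definition l_prod :: "nat \<Rightarrow> lvec \<Rightarrow> lvec \<Rightarrow> lvec" where
  "l_prod n a b =
     (\<Sum>i\<in>Poly_Mapping.keys a. \<Sum>j\<in>Poly_Mapping.keys b.
        smul (Poly_Mapping.lookup a i * Poly_Mapping.lookup b j) (basis_prod n i j))"

definition W_space :: "nat \<Rightarrow> lvec set" where
  "W_space n = {z. Poly_Mapping.keys z \<subseteq> BV ` {..<n} \<union> {BW}}"


section \<open>The Lie algebra \<open>L\<^sup>*\<close>\<close>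

definition disj_union :: "nat set \<Rightarrow> nat set \<Rightarrow> nat set" where
  "disj_union A B = (if A \<inter> B = {} then A \<union> B else {})"

text \<open>
  An element of the direct sum \<open>W\<^sup>*\<close> is the finitely supported function sending a
  non-empty set \<open>A\<close> to its component in \<open>W\<^sub>A\<close>. Here \<open>copy A z\<close> is \<open>z\<^sub>A\<close>, with \<open>z\<^sub>\<emptyset> = 0\<close>.
  An element \<open>(a, s)\<close> of \<open>L\<^sup>*\<close> stands for \<open>a + s x\<close>.
\<close>

type_synonym wstar = "nat set \<Rightarrow>\<^sub>0 lvec"
type_synonym lstar = "wstar \<times> bit"

definition copy :: "nat set \<Rightarrow> lvec \<Rightarrow> wstar" where
  "copy A z = (if A = {} then 0 else Poly_Mapping.single A z)"

definition Wstar :: "nat \<Rightarrow> wstar set" where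
  "Wstar n = {a. {} \<notin> Poly_Mapping.keys a \<and> (\<forall>A. Poly_Mapping.lookup a A \<in> W_space n)}"

definition Lstar :: "nat \<Rightarrow> lstar set" where
  "Lstar n = Wstar n \<times> UNIV"

definition wstar_prod :: "nat \<Rightarrow> wstar \<Rightarrow> wstar \<Rightarrow> wstar" where
  "wstar_prod n a b =
     (\<Sum>A\<in>Poly_Mapping.keys a. \<Sum>B\<in>Poly_Mapping.keys b.
        copy (disj_union A B) (l_prod n (Poly_Mapping.lookup a A) (Poly_Mapping.lookup b B)))"

text \<open>The linear extension of \<open>z\<^sub>A \<mapsto> (z \<cdot> x)\<^sub>A\<close>, which is both \<open>a \<cdot> x\<close> and \<open>x \<cdot> a\<close>.\<close>

definition wstar_x :: "nat \<Rightarrow> wstar \<Rightarrow> wstar" where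
  "wstar_x n a = (\<Sum>A\<in>Poly_Mapping.keys a. copy A (l_prod n (Poly_Mapping.lookup a A) xL))"

fun lstar_prod :: "nat \<Rightarrow> lstar \<Rightarrow> lstar \<Rightarrow> lstar" where
  "lstar_prod n (a, s) (b, t) = (wstar_prod n a b + smul t (wstar_x n a) + smul s (wstar_x n b), 0)"

definition vstar :: "nat \<Rightarrow> nat set \<Rightarrow> lstar" where "vstar i A = (copy A (vL i), 0)"
definition wwstar :: "nat set \<Rightarrow> lstar" where "wwstar A = (copy A wL, 0)"
definition xstar :: lstar where "xstar = (0, 1)"


section \<open>The group \<open>G\<close>\<close>

definition linear_on_Lstar :: "nat \<Rightarrow> (lstar \<Rightarrow> lstar) \<Rightarrow> bool" where
  "linear_on_Lstar n f \<longleftrightarrow>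
     (\<forall>y\<in>Lstar n. \<forall>z\<in>Lstar n. f (y + z) = f y + f z) \<and>
     (\<forall>c. \<forall>z\<in>Lstar n. f (smul c z) = smul c (f z))"

text \<open>
  Operators on \<open>L\<^sup>*\<close> are extensional functions. They act on the right, so the
  product of \<open>f\<close> and \<open>g\<close> applies \<open>f\<close> first.
\<close>

definition GL_Lstar :: "nat \<Rightarrow> (lstar \<Rightarrow> lstar) monoid" where
  "GL_Lstar n =
     \<lparr>carrier = {f \<in> Bij (Lstar n). linear_on_Lstar n f},
      monoid.mult = \<lambda>f g. compose (Lstar n) g f,
      one = \<lambda>z\<in>Lstar n. z\<rparr>"

definition ad :: "nat \<Rightarrow> lstar \<Rightarrow> lstar \<Rightarrow> lstar" where
  "ad n y = (\<lambda>z\<in>Lstar n. lstar_prod n z y)"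

definition one_plus_ad :: "nat \<Rightarrow> lstar \<Rightarrow> lstar \<Rightarrow> lstar" where
  "one_plus_ad n y = (\<lambda>z\<in>Lstar n. z + ad n y z)"

definition V_group :: "nat \<Rightarrow> nat \<Rightarrow> (lstar \<Rightarrow> lstar) set" where
  "V_group n i = generate (GL_Lstar n) {one_plus_ad n (vstar i A) |A. True}"

definition W_group :: "nat \<Rightarrow> (lstar \<Rightarrow> lstar) set" where
  "W_group n = generate (GL_Lstar n) {one_plus_ad n (wwstar A) |A. True}"

definition G_group :: "nat \<Rightarrow> (lstar \<Rightarrow> lstar) monoid" where
  "G_group n = (GL_Lstar n)\<lparr>carrier :=
     generate (GL_Lstar n) ({one_plus_ad n xstar} \<union> (\<Union>i<n. V_group n i) \<union> W_group n)\<rparr>"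


section \<open>Engel elements, normal closures and nilpotency\<close>

definition commutator :: "('a, 'b) monoid_scheme \<Rightarrow> 'a \<Rightarrow> 'a \<Rightarrow> 'a" where
  "commutator G a b = inv\<^bsub>G\<^esub> a \<otimes>\<^bsub>G\<^esub> inv\<^bsub>G\<^esub> b \<otimes>\<^bsub>G\<^esub> a \<otimes>\<^bsub>G\<^esub> b"

definition left_3_engel :: "('a, 'b) monoid_scheme \<Rightarrow> 'a \<Rightarrow> bool" where
  "left_3_engel G a \<longleftrightarrow> a \<in> carrier G \<and>
     (\<forall>g\<in>carrier G. commutator G (commutator G (commutator G g a) a) a = \<one>\<^bsub>G\<^esub>)"

definition normal_closure :: "('a, 'b) monoid_scheme \<Rightarrow> 'a set \<Rightarrow> 'a set" where
  "normal_closure G S = generate G {inv\<^bsub>G\<^esub> g \<otimes>\<^bsub>G\<^esub> s \<otimes>\<^bsub>G\<^esub> g |g s. g \<in> carrier G \<and> s \<in> S}"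

primrec lower_central :: "('a, 'b) monoid_scheme \<Rightarrow> nat \<Rightarrow> 'a set" where
  "lower_central G 0 = carrier G"
| "lower_central G (Suc k) =
     generate G {commutator G a b |a b. a \<in> lower_central G k \<and> b \<in> carrier G}"

definition nilpotent_group :: "('a, 'b) monoid_scheme \<Rightarrow> bool" where
  "nilpotent_group G \<longleftrightarrow> (\<exists>k. lower_central G k = {\<one>\<^bsub>G\<^esub>})"

end

theory Submission
  imports Defs
begin

text \<open>
  Put \<open>N = n + 1 = 2\<^sup>m - 1\<close> and rename the basis of \<open>L\<close> as \<open>f\<^sub>0 = w\<close>, \<open>f\<^sub>a = v(n - a)\<close> for
  \<open>1 \<le> a \<le> n\<close>, and \<open>f\<^sub>N = x\<close>. Modulo 2 the product becomes
  \<open>f\<^sub>a \<cdot> f\<^sub>b = binom(a + b, a) f\<^sub>a\<^sub>+\<^sub>b\<^sub>-\<^sub>1\<close> with \<open>f\<^sub>-\<^sub>1 = 0\<close>, and the coefficient vanishes when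
  \<open>a + b > N\<close>. So \<open>L\<close> is the Zassenhaus algebra of the derivations \<open>t\<^bsup>(a)\<^esup> d/dt\<close> of the truncated
  divided power algebra over the field with two elements. Giving \<open>x\<close> the label \<open>\<emptyset>\<close>, the same formula
  describes \<open>L\<^sup>*\<close>: \<open>(f\<^sub>a)\<^sub>A \<cdot> (f\<^sub>b)\<^sub>B\<close> is \<open>binom(a + b, a) (f\<^sub>a\<^sub>+\<^sub>b\<^sub>-\<^sub>1)\<^sub>A\<^sub>\<union>\<^sub>B\<close> for disjoint labels and
  zero otherwise (\<open>lstar_prod_witt_elem\<close>). Every multilinear identity in \<open>L\<^sup>*\<close> is therefore a parity
  statement about binomial coefficients; the Jacobi identity says that twice a trinomial coefficient
  is even.

  If \<open>ad(y)\<^sup>2 = 0\<close> and \<open>(s \<cdot> y) \<cdot> (t \<cdot> y) = 0\<close> for all \<open>s\<close>, \<open>t\<close>, then \<open>1 + ad(y)\<close> is an involution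
  and, by the Jacobi identity, an automorphism of \<open>L\<^sup>*\<close>. This applies to all generators of \<open>G\<close>, so
  \<open>G\<close> consists of automorphisms and \<open>g\<^sup>-\<^sup>1 (1 + ad(y)) g = 1 + ad(y g)\<close>.

  For the Engel property, let \<open>X = ad(x)\<close>, \<open>Y = ad(x g)\<close>, \<open>a = 1 + X\<close> and \<open>b = 1 + Y = g\<^sup>-\<^sup>1 a g\<close>. As
  \<open>a\<close> is an involution, \<open>[g, a] = b a\<close> and \<open>[g, a, a, a] = (b a)\<^sup>4\<close>. The element \<open>x\<close> is a sandwich:
  \<open>X Z X = 0\<close> for \<open>Z = ad(z)\<close> with any \<open>z\<close> (\<open>xstar_sandwich\<close>), because \<open>X\<close> maps \<open>L\<^sup>*\<close> into the span of the
  \<open>v(0)\<^sub>A\<close>, and no multiple of such an element has a component along \<open>w\<close>. With \<open>X\<^sup>2 = Y\<^sup>2 = X Y X = 0\<close>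
  both \<open>a b a b\<close> and \<open>b a b a\<close> equal \<open>1 + X Y + Y X + Y X Y\<close>, so \<open>(b a)\<^sup>4 = (b a b a) (a b a b) = 1\<close>.

  For the second claim, \<open>[1 + ad(y), 1 + ad(z)] = 1 + ad(y \<cdot> z)\<close> for elements \<open>y\<close>, \<open>z\<close> as above
  (\<open>commutator_one_plus_ad\<close>). Infinite labels can be split into two infinite halves again and again.
  As \<open>x \<cdot> f\<^sub>0 = f\<^sub>n\<close> and \<open>f\<^sub>a\<^sub>+\<^sub>1 \<cdot> f\<^sub>0 = f\<^sub>a\<close>, the normal closure of \<open>1 + ad(x)\<close> contains
  \<open>1 + ad((f\<^sub>a)\<^sub>A)\<close> for every infinite \<open>A\<close> and \<open>a \<le> n\<close>. As \<open>f\<^sub>0 \<cdot> f\<^sub>1 = f\<^sub>0\<close>, the elements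
  \<open>1 + ad((f\<^sub>0)\<^sub>A)\<close> with \<open>A\<close> infinite stay in every term of the lower central series; they are not
  trivial, since they move \<open>x\<close>.
\<close>

section \<open>Parities of binomial coefficients\<close>

text \<open>
  By absorption, \<open>2\<^sup>m\<close> divides \<open>k binom(2\<^sup>m, k)\<close>, and it cannot divide \<open>k\<close>.
\<close>
lemma even_choose_power2:
  assumes "0 < k" "k < 2 ^ m"
  shows "even ((2 ^ m :: nat) choose k)"
proof (rule ccontr)
  assume "odd ((2 ^ m :: nat) choose k)"
  then have cop: "coprime ((2::nat) ^ m) ((2 ^ m) choose k)"
    by simp
  obtain j where j: "k = Suc j" using assms gr0_conv_Suc by auto
  have "k * ((2 ^ m) choose k) = 2 ^ m * ((2 ^ m - 1) choose j)"
    unfolding j by (rule binomial_absorption)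
  then have "(2::nat) ^ m dvd k * ((2 ^ m) choose k)" by simp
  then have "2 ^ m dvd k"
    using cop coprime_dvd_mult_left_iff by blast
  then show False using assms by (auto dest: dvd_imp_le)
qed

text \<open>
  A case of Kummer's theorem: the binary addition of \<open>a\<close> and \<open>b\<close> produces a carry out of the first \<open>m\<close>
  digits. Modulo 2, the Vandermonde sum over \<open>2\<^sup>m + r\<close> reduces to \<open>binom(r, a)\<close> with \<open>r < a\<close>.
\<close>
lemma even_choose_carry:
  assumes "a < 2 ^ m" "b < 2 ^ m" "2 ^ m \<le> a + b"
  shows "even ((a + b) choose a)"
proof -
  define r where "r = a + b - 2 ^ m"
  have ab: "a + b = 2 ^ m + r" and ra: "r < a" using assms by (auto simp: r_def)
  have "(a + b) choose a = (\<Sum>k\<le>a. ((2 ^ m) choose k) * (r choose (a - k)))"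
    unfolding ab by (rule vandermonde[symmetric])
  moreover have "even (\<Sum>k\<le>a. ((2 ^ m) choose k) * (r choose (a - k)))"
  proof (rule dvd_sum)
    fix k assume "k \<in> {..a}"
    then show "even (((2 ^ m) choose k) * (r choose (a - k)))"
      using even_choose_power2[of k m] ra assms(1) by (cases "k = 0") (auto simp: binomial_eq_0)
  qed
  ultimately show ?thesis by simp
qed

lemma odd_choose_power2_minus_1:
  "k < 2 ^ m \<Longrightarrow> odd ((2 ^ m - 1) choose k)"
proof (induction k)
  case (Suc k)
  have "Suc (2 ^ m - 1) = (2::nat) ^ m" by simp
  then have "(2 ^ m) choose (Suc k) = ((2 ^ m - 1) choose k) + ((2 ^ m - 1) choose (Suc k))"
    by (metis binomial_Suc_Suc)
  then show ?case using even_choose_power2[of "Suc k" m] Suc by (metis Suc_lessD even_add zero_less_Suc)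
qed simp

text \<open>
  Since \<open>2\<^sup>m - 1 - b\<close> is congruent to \<open>-1 - b\<close> modulo \<open>2\<^sup>m\<close>, this is the reflection
  \<open>binom(-1 - b, a) = (-1)\<^sup>a binom(a + b, a)\<close> modulo 2. It turns the coefficients in the definition of
  \<open>L\<close> into symmetric ones. Both sides satisfy the same Pascal recursion modulo 2.
\<close>
lemma even_choose_reflect:
  "b < 2 ^ m \<Longrightarrow> a < 2 ^ m \<Longrightarrow> even ((2 ^ m - 1 - b) choose a) = even ((a + b) choose a)"
proof (induction b arbitrary: a)
  case 0
  then show ?case using odd_choose_power2_minus_1 by simp
next
  case (Suc b)
  have lt: "b < 2 ^ m" using Suc.prems by simp
  from Suc.prems(2) show ?case
  proof (induction a)
    case (Suc a)
    have "Suc (2 ^ m - 1 - Suc b) = 2 ^ m - 1 - b" using \<open>Suc b < 2 ^ m\<close> by simp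
    then have L: "(2 ^ m - 1 - b) choose (Suc a)
        = ((2 ^ m - 1 - Suc b) choose a) + ((2 ^ m - 1 - Suc b) choose (Suc a))"
      by (metis binomial_Suc_Suc)
    have R: "(Suc a + Suc b) choose (Suc a) = ((a + Suc b) choose a) + ((Suc a + b) choose (Suc a))"
      by simp
    from L R Suc \<open>b < 2 ^ m \<Longrightarrow> Suc a < 2 ^ m \<Longrightarrow> even ((2 ^ m - 1 - b) choose Suc a) = even ((Suc a + b) choose Suc a)\<close> [OF lt Suc.prems]
    show ?case by (metis Suc_lessD even_add)
  qed simp
qed

lemma even_central_choose: "0 < k \<Longrightarrow> even ((k + k) choose k)"
proof -
  assume "0 < k"
  then obtain j where j: "k = Suc j" using gr0_conv_Suc by auto
  have "(Suc j + Suc j) choose (Suc j) = ((j + Suc j) choose j) + ((j + Suc j) choose (Suc j))" by simp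
  also have "(j + Suc j) choose j = (j + Suc j) choose (Suc j)"
    using binomial_symmetric[of j "j + Suc j"] by simp
  finally show ?thesis unfolding j by simp
qed

text \<open>
  The structure constants of the divided power derivations \<open>f\<^sub>a = t\<^bsup>(a)\<^esup> d/dt\<close> modulo 2. The product
  \<open>f\<^sub>0 \<cdot> f\<^sub>0\<close> is a multiple of \<open>f\<^sub>-\<^sub>1 = 0\<close>; the value 0 at \<open>a + b = 0\<close> makes the truncated index
  \<open>a + b - 1\<close> harmless.
\<close>
definition witt_coeff :: "nat \<Rightarrow> nat \<Rightarrow> nat" where
  "witt_coeff a b = (if a + b = 0 then 0 else (a + b) choose a)"

lemma witt_coeff_commute: "witt_coeff a b = witt_coeff b a"
  using binomial_symmetric[of a "a + b"] by (simp add: witt_coeff_def add.commute)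

text \<open>
  Multiplied by the factorials, the coefficient of \<open>(f\<^sub>a \<cdot> f\<^sub>b) \<cdot> f\<^sub>c\<close> depends on the bracketing only
  through the factor \<open>a + b\<close>. The hypothesis excludes the outer product \<open>f\<^sub>0 \<cdot> f\<^sub>0\<close>, whose coefficient
  is 0 only by convention.
\<close>
lemma witt_coeff_pair_fact:
  assumes "2 \<le> a + b + c"
  shows "fact a * fact b * fact c * (witt_coeff a b * witt_coeff (a + b - 1) c)
    = (a + b) * fact (a + b + c - 1)"
proof (cases "a + b = 0")
  case False
  have 1: "fact a * fact b * ((a + b) choose a) = (fact (a + b) :: nat)"
    using binomial_fact_lemma[of a "a + b"] by simp
  have 2: "fact (a + b) = (a + b) * (fact (a + b - 1) :: nat)"
    using False fact_reduce[of "a + b", where ?'a = nat] by simp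
  have 3: "fact (a + b - 1) * fact c * ((a + b - 1 + c) choose (a + b - 1)) = (fact (a + b + c - 1) :: nat)"
    using binomial_fact_lemma[of "a + b - 1" "a + b - 1 + c"] False
    by (metis Nat.add_diff_assoc2 add_diff_cancel_left' le_add1 less_one linorder_not_less)
  have nz: "a + b - 1 + c \<noteq> 0" using assms by simp
  have "fact a * fact b * fact c * (witt_coeff a b * witt_coeff (a + b - 1) c)
     = (fact a * fact b * ((a + b) choose a)) * fact c * ((a + b - 1 + c) choose (a + b - 1))"
    using False nz by (simp add: witt_coeff_def)
  also have "\<dots> = (a + b) * (fact (a + b - 1) * fact c * ((a + b - 1 + c) choose (a + b - 1)))"
    unfolding 1 2 by simp
  finally show ?thesis unfolding 3 .
qed (simp add: witt_coeff_def)

text \<open>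
  The Jacobi identity for the \<open>f\<^sub>a\<close>. By the previous lemma the three terms are proportional to \<open>a + b\<close>,
  \<open>b + c\<close> and \<open>c + a\<close>, whose sum is \<open>2 (a + b + c)\<close>; so the total is twice the trinomial coefficient.
\<close>
lemma even_witt_coeff_jacobi:
  "even (witt_coeff a b * witt_coeff (a + b - 1) c + witt_coeff b c * witt_coeff (b + c - 1) a
       + witt_coeff c a * witt_coeff (c + a - 1) b)" (is "even ?S")
proof (cases "2 \<le> a + b + c")
  case True
  let ?F = "fact a * fact b * fact c :: nat"
  let ?M = "((a + b) choose a) * ((a + b + c) choose (a + b))"
  have M: "?F * ?M = fact (a + b + c)"
  proof -
    have "fact a * fact b * ((a + b) choose a) = (fact (a + b) :: nat)"
      using binomial_fact_lemma[of a "a + b"] by simp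
    moreover have "fact (a + b) * fact c * ((a + b + c) choose (a + b)) = (fact (a + b + c) :: nat)"
      using binomial_fact_lemma[of "a + b" "a + b + c"] by simp
    ultimately show ?thesis by (metis (no_types, lifting) mult.assoc mult.commute)
  qed
  have "?F * ?S = (a + b) * fact (a + b + c - 1) + (b + c) * fact (a + b + c - 1)
      + (c + a) * fact (a + b + c - 1)"
    using witt_coeff_pair_fact[of a b c] witt_coeff_pair_fact[of b c a]
      witt_coeff_pair_fact[of c a b] True
    by (simp add: algebra_simps)
  also have "\<dots> = 2 * ((a + b + c) * fact (a + b + c - 1))"
    by (simp add: algebra_simps)
  also have "(a + b + c) * fact (a + b + c - 1) = (fact (a + b + c) :: nat)"
    by (rule fact_reduce[symmetric, where ?'a = nat, simplified of_nat_id]) (use True in linarith)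
  also have "\<dots> = ?F * ?M" using M by simp
  finally have "?F * ?S = ?F * (2 * ?M)" by (metis mult.left_commute)
  then have "?S = 2 * ?M" by simp
  then show ?thesis by simp
next
  case False
  then consider "a = 0" "b = 0" "c = 0" | "a = 1" "b = 0" "c = 0" | "a = 0" "b = 1" "c = 0"
    | "a = 0" "b = 0" "c = 1" by linarith
  then show ?thesis by cases (simp_all add: witt_coeff_def)
qed

section \<open>Bilinearity of the products\<close>

lemma char2_lvec [simp]: "p + p = (0 :: 'b \<Rightarrow>\<^sub>0 bit)"
  by (rule poly_mapping_eqI) (simp add: lookup_add)

lemma char2_wstar [simp]: "p + p = (0 :: 'c \<Rightarrow>\<^sub>0 'b \<Rightarrow>\<^sub>0 bit)"
  by (rule poly_mapping_eqI) (simp add: lookup_add)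

lemma char2_lstar [simp]: "z + z = (0 :: lstar)"
  by (cases z) (simp add: zero_prod_def)

lemma char2_lstar_left [simp]: "z + (z + u) = (u :: lstar)"
  by (simp flip: add.assoc)

lemma char2_add_eq_0_iff: "a + b = 0 \<longleftrightarrow> a = (b :: lstar)"
  using eq_neg_iff_add_eq_0[of a b] minus_unique[OF char2_lstar[of b]] by simp

lemma smul_0 [simp]: "smul 0 a = 0" "smul c 0 = 0" and smul_1 [simp]: "smul 1 a = a"
  by (simp_all add: smul_def)

lemma smul_add_right: "smul c (a + b) = smul c a + smul c (b :: 'a :: monoid_add)"
  by (simp add: smul_def)

lemma smul_add_left:
  assumes "a + a = (0 :: 'a :: monoid_add)"
  shows "smul (c + d) a = smul c a + smul d a"
  using assms by (cases c; cases d) simp_all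

lemma copy_0 [simp]: "copy A 0 = 0"
  by (simp add: copy_def)

lemma copy_add: "copy A (a + b) = copy A a + copy A b"
  by (simp add: copy_def single_add)

lemma l_prod_add_left: "l_prod n (a + b) c = l_prod n a c + l_prod n b c"
  unfolding l_prod_def
  by (rule setsum_keys_plus_distrib)
    (simp_all add: distrib_right smul_add_left sum.distrib del: add_bit_eq_xor mult_bit_eq_and)

lemma l_prod_add_right: "l_prod n c (a + b) = l_prod n c a + l_prod n c b"
  unfolding l_prod_def sum.distrib[symmetric]
  by (rule sum.cong[OF refl], rule setsum_keys_plus_distrib)
    (simp_all add: distrib_left smul_add_left del: add_bit_eq_xor mult_bit_eq_and)

lemma l_prod_0 [simp]: "l_prod n 0 c = 0" "l_prod n c 0 = 0"
  by (simp_all add: l_prod_def)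

lemma l_prod_basis [simp]:
  "l_prod n (Poly_Mapping.single i 1) (Poly_Mapping.single j 1) = basis_prod n i j"
  by (simp add: l_prod_def)

lemma wstar_prod_add_left: "wstar_prod n (a + b) c = wstar_prod n a c + wstar_prod n b c"
  unfolding wstar_prod_def
  by (rule setsum_keys_plus_distrib) (simp_all add: l_prod_add_left copy_add sum.distrib)

lemma wstar_prod_add_right: "wstar_prod n c (a + b) = wstar_prod n c a + wstar_prod n c b"
  unfolding wstar_prod_def sum.distrib[symmetric]
  by (rule sum.cong[OF refl], rule setsum_keys_plus_distrib)
    (simp_all add: l_prod_add_right copy_add)

lemma wstar_x_add: "wstar_x n (a + b) = wstar_x n a + wstar_x n b"
  unfolding wstar_x_def
  by (rule setsum_keys_plus_distrib) (simp_all add: l_prod_add_left copy_add)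

lemma lstar_prod_add_left: "lstar_prod n (a + b) c = lstar_prod n a c + lstar_prod n b c"
  by (cases a; cases b; cases c)
    (simp add: wstar_prod_add_left wstar_x_add smul_add_left smul_add_right
      add_ac del: add_bit_eq_xor)

lemma lstar_prod_add_right: "lstar_prod n c (a + b) = lstar_prod n c a + lstar_prod n c b"
  by (cases a; cases b; cases c)
    (simp add: wstar_prod_add_right wstar_x_add smul_add_left smul_add_right
      add_ac del: add_bit_eq_xor)

lemmas lstar_prod_add = lstar_prod_add_left lstar_prod_add_right

lemma lstar_prod_0 [simp]: "lstar_prod n 0 c = 0" "lstar_prod n c 0 = 0"
  by (cases c; simp add: zero_prod_def wstar_prod_def wstar_x_def)+

lemma poly_mapping_sum_single:
  "(\<Sum>k\<in>Poly_Mapping.keys p. Poly_Mapping.single k (Poly_Mapping.lookup p k)) = p"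
  by (rule poly_mapping_eqI)
    (simp add: lookup_sum lookup_single when_def in_keys_iff)

section \<open>The divided power basis of \<open>L\<^sup>*\<close>\<close>

lemma smul_of_nat: "smul (of_nat k) z = (if even k then 0 else z)"
proof -
  have "(of_nat k :: bit) = (if even k then 0 else 1)"
    by (induction k) (auto simp del: add_bit_eq_xor)
  then show ?thesis by simp
qed

text \<open>
  The basis vector \<open>f\<^sub>a\<close> of \<open>L\<close>, for \<open>a \<le> n + 1\<close>.
\<close>
definition witt_basis :: "nat \<Rightarrow> nat \<Rightarrow> lbasis" where
  "witt_basis n a = (if a = 0 then BW else if a = n + 1 then BX else BV (n - a))"

definition witt_index :: "nat \<Rightarrow> nat set \<Rightarrow> nat \<Rightarrow> bool" where
  "witt_index n A a \<longleftrightarrow> (if A = {} then a = n + 1 else a \<le> n)"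

text \<open>
  The basis element \<open>(f\<^sub>a)\<^sub>A\<close> of \<open>L\<^sup>*\<close>, where \<open>x\<close> is viewed as \<open>f\<^sub>n\<^sub>+\<^sub>1\<close> with the label \<open>\<emptyset>\<close>. The pairs
  \<open>(A, a)\<close> that name a basis element are those with \<open>witt_index n A a\<close>. With this convention all
  products in \<open>L\<^sup>*\<close>, including those with \<open>x\<close>, follow a single formula.
\<close>
definition witt_elem :: "nat \<Rightarrow> nat set \<Rightarrow> nat \<Rightarrow> lstar" where
  "witt_elem n A a =
     (if A = {} then xstar
      else (Poly_Mapping.single A (Poly_Mapping.single (witt_basis n a) 1), 0))"

lemma wstar_prod_single:
  "wstar_prod n (Poly_Mapping.single A p) (Poly_Mapping.single B q)
    = copy (disj_union A B) (l_prod n p q)"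
  by (simp add: wstar_prod_def)

lemma wstar_x_single: "wstar_x n (Poly_Mapping.single A p) = copy A (l_prod n p xL)"
  by (simp add: wstar_x_def)

lemma wstar_0 [simp]: "wstar_prod n 0 b = 0" "wstar_prod n b 0 = 0" "wstar_x n 0 = 0"
  by (simp_all add: wstar_prod_def wstar_x_def)

lemma W_space_0: "0 \<in> W_space n"
  by (simp add: W_space_def)

lemma W_space_add: "p \<in> W_space n \<Longrightarrow> q \<in> W_space n \<Longrightarrow> p + q \<in> W_space n"
  unfolding W_space_def using Poly_Mapping.keys_add[of p q] by blast

lemma W_space_single:
  assumes "b \<in> BV ` {..<n} \<union> {BW}"
  shows "Poly_Mapping.single b c \<in> W_space n"
  using assms by (cases "c = 0") (auto simp: W_space_def)

lemma Wstar_0: "0 \<in> Wstar n"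
  by (simp add: Wstar_def W_space_0)

lemma Wstar_add: "p \<in> Wstar n \<Longrightarrow> q \<in> Wstar n \<Longrightarrow> p + q \<in> Wstar n"
  unfolding Wstar_def using Poly_Mapping.keys_add[of p q]
  by (auto simp: lookup_add W_space_add)

lemma Lstar_0 [simp]: "0 \<in> Lstar n"
  by (simp add: Lstar_def Wstar_0 zero_prod_def)

lemma Lstar_add [simp]: "y \<in> Lstar n \<Longrightarrow> z \<in> Lstar n \<Longrightarrow> y + z \<in> Lstar n"
  by (cases y; cases z) (simp add: Lstar_def Wstar_add)

lemma witt_elem_in_Lstar [simp]:
  assumes "witt_index n A a"
  shows "witt_elem n A a \<in> Lstar n"
proof (cases "A = {}")
  case True
  then show ?thesis by (simp add: witt_elem_def xstar_def Lstar_def Wstar_0)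
next
  case False
  have "Poly_Mapping.single (witt_basis n a) 1 \<in> W_space n"
    using assms False by (intro W_space_single) (auto simp: witt_index_def witt_basis_def)
  then have "Poly_Mapping.single A (Poly_Mapping.single (witt_basis n a) 1) \<in> Wstar n"
    using False by (auto simp: Wstar_def lookup_single when_def W_space_0)
  then show ?thesis using False by (simp add: witt_elem_def Lstar_def)
qed

text \<open>
  The elements \<open>(f\<^sub>a)\<^sub>A\<close> span \<open>L\<^sup>*\<close>; over the field with two elements a span is an additive closure.
  An identity that is additive in each variable can thus be checked on basis elements.
\<close>
lemma Lstar_induct [consumes 1, case_names zero add witt]:
  assumes z: "z \<in> Lstar n"
    and zero: "P 0"
    and add: "\<And>y z. y \<in> Lstar n \<Longrightarrow> z \<in> Lstar n \<Longrightarrow> P y \<Longrightarrow> P z \<Longrightarrow> P (y + z)"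
    and witt: "\<And>A a. witt_index n A a \<Longrightarrow> P (witt_elem n A a)"
  shows "P z"
proof -
  define Q where "Q z \<longleftrightarrow> z \<in> Lstar n \<and> P z" for z
  have Q_sum: "Q (\<Sum>i\<in>I. f i)" if "finite I" "\<And>i. i \<in> I \<Longrightarrow> Q (f i)" for I and f :: "'i \<Rightarrow> lstar"
    using that by (induction I rule: finite_induct) (auto simp: Q_def zero add)
  obtain p s where ps: "z = (p, s)" by (cases z)
  have p: "p \<in> Wstar n" using z ps by (simp add: Lstar_def)
  have pair_sum: "(\<Sum>i\<in>I. (g i, 0 :: bit)) = (\<Sum>i\<in>I. g i, 0)" for I and g :: "'i \<Rightarrow> wstar"
    by (induction I rule: infinite_finite_induct) (simp_all add: zero_prod_def)
  have single_sum: "(\<Sum>i\<in>I. Poly_Mapping.single A (g i)) = Poly_Mapping.single A (\<Sum>i\<in>I. g i)"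
    for A :: "nat set" and I and g :: "'i \<Rightarrow> lvec"
    by (induction I rule: infinite_finite_induct) (simp_all add: single_add)
  have comp: "Q (Poly_Mapping.single A (Poly_Mapping.lookup p A), 0)"
    if A: "A \<in> Poly_Mapping.keys p" for A
  proof -
    let ?q = "Poly_Mapping.lookup p A"
    have "A \<noteq> {}" and q: "Poly_Mapping.keys ?q \<subseteq> BV ` {..<n} \<union> {BW}"
      using p A by (auto simp: Wstar_def W_space_def)
    have "Q (Poly_Mapping.single A (Poly_Mapping.single b (Poly_Mapping.lookup ?q b)), 0)"
      if b: "b \<in> Poly_Mapping.keys ?q" for b
    proof -
      obtain a where a: "a \<le> n" "b = witt_basis n a"
      proof (cases b)
        case (BV i)
        with b q have "i < n" by auto
        then show ?thesis by (intro that[of "n - i"]) (auto simp: witt_basis_def BV)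
      next
        case BW
        then show ?thesis by (intro that[of 0]) (auto simp: witt_basis_def)
      next
        case BX
        with b q show ?thesis by auto
      qed
      have "Poly_Mapping.lookup ?q b = 1" using b by (simp add: in_keys_iff)
      then have "(Poly_Mapping.single A (Poly_Mapping.single b (Poly_Mapping.lookup ?q b)), 0)
          = witt_elem n A a"
        using \<open>A \<noteq> {}\<close> a by (simp add: witt_elem_def)
      moreover have "witt_index n A a" using \<open>A \<noteq> {}\<close> a by (simp add: witt_index_def)
      ultimately show ?thesis using witt by (simp add: Q_def)
    qed
    then have "Q (\<Sum>b\<in>Poly_Mapping.keys ?q.
        (Poly_Mapping.single A (Poly_Mapping.single b (Poly_Mapping.lookup ?q b)), 0))"
      by (intro Q_sum) auto
    then show ?thesis by (simp add: pair_sum single_sum poly_mapping_sum_single)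
  qed
  have "Q (\<Sum>A\<in>Poly_Mapping.keys p. (Poly_Mapping.single A (Poly_Mapping.lookup p A), 0))"
    by (intro Q_sum comp) auto
  then have "Q (p, 0)" by (simp add: pair_sum poly_mapping_sum_single)
  moreover have "Q (smul s xstar)"
    using zero witt[of "{}" "n + 1"] witt_elem_in_Lstar[of n "{}" "n + 1"]
    by (cases s) (auto simp: Q_def witt_index_def witt_elem_def)
  moreover have "z = (p, 0) + smul s xstar"
    by (cases s) (simp_all add: ps xstar_def)
  ultimately show ?thesis using add by (simp add: Q_def)
qed

locale witt_parameters =
  fixes m n :: nat
  assumes two_le_m: "m \<ge> 2" and n_eq: "n = 2 ^ m - 2"
begin

lemma power_m: "2 ^ m = n + 2"
proof -
  have "(2::nat) ^ 1 \<le> 2 ^ m" using two_le_m by (intro power_increasing) auto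
  then show ?thesis by (simp add: n_eq)
qed

lemma two_le_n: "2 \<le> n"
proof -
  have "(2::nat) ^ 2 \<le> 2 ^ m" using two_le_m by (intro power_increasing) auto
  then show ?thesis by (simp add: n_eq)
qed

lemma even_witt_coeff:
  assumes "a \<le> n + 1" "b \<le> n + 1" "n + 1 < a + b"
  shows "even (witt_coeff a b)"
  using even_choose_carry[of a m b] assms by (simp add: witt_coeff_def power_m)

lemma even_witt_coeff_self: "even (witt_coeff a a)"
  using even_central_choose[of a] by (auto simp: witt_coeff_def)

text \<open>
  The case that carries the content is that of two \<open>v\<close>'s. If the coefficient is odd, then
  \<open>3 \<le> a + b \<le> n + 1\<close>, and reducing \<open>(n - a) + (n - b)\<close> modulo \<open>n - 1\<close> subtracts \<open>n - 1\<close> exactly once.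
\<close>
lemma basis_prod_witt_basis:
  assumes a: "a \<le> n + 1" and b: "b \<le> n + 1"
  shows "basis_prod n (witt_basis n a) (witt_basis n b)
    = smul (of_nat (witt_coeff a b)) (Poly_Mapping.single (witt_basis n (a + b - 1)) 1)"
proof -
  note n2 = two_le_n
  consider "a = 0" | "b = 0" "a \<noteq> 0" | "a = n + 1" "b \<noteq> 0" | "b = n + 1" "a \<noteq> 0"
    | "1 \<le> a" "a \<le> n" "1 \<le> b" "b \<le> n"
    using a b by linarith
  then show ?thesis
  proof cases
    case 1
    with b n2 show ?thesis
      by (cases "b = 0 \<or> b = n + 1") (auto simp: witt_basis_def witt_coeff_def Suc_diff_le)
  next
    case 2
    with a n2 show ?thesis
      by (cases "a = n + 1") (auto simp: witt_basis_def witt_coeff_def Suc_diff_le)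
  next
    case 3
    then have "even (witt_coeff a b)" by (intro even_witt_coeff a b) auto
    with 3 show ?thesis by (auto simp: witt_basis_def smul_of_nat)
  next
    case 4
    then have "even (witt_coeff a b)" by (intro even_witt_coeff a b) auto
    with 4 show ?thesis by (auto simp: witt_basis_def smul_of_nat)
  next
    case 5
    have "even ((2 ^ m - 1 - b) choose a) = even ((a + b) choose a)"
      using a b by (intro even_choose_reflect) (auto simp: power_m)
    moreover have "2 ^ m - 1 - b = n - b + 1" using 5 by (simp add: power_m)
    ultimately have par: "even ((n - b + 1) choose a) = even (witt_coeff a b)"
      using 5 by (simp add: witt_coeff_def)
    show ?thesis
    proof (cases "even (witt_coeff a b)")
      case True
      with 5 par show ?thesis by (auto simp: witt_basis_def smul_of_nat)
    next
      case False
      have le: "a + b \<le> n + 1" using even_witt_coeff[OF a b] False by linarith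
      have "\<not> (a = 1 \<and> b = 1)" using even_witt_coeff_self False by auto
      then have "3 \<le> a + b" using 5 by linarith
      then have "(n - a + (n - b)) mod (n - 1) = n - (a + b - 1)"
      proof -
        have "n - a + (n - b) = (n - 1) + (n - (a + b - 1))" using 5 le by linarith
        moreover have "n - (a + b - 1) < n - 1" using \<open>3 \<le> a + b\<close> n2 by linarith
        ultimately show ?thesis by (simp only: mod_add_self1 mod_less)
      qed
      with 5 par False le show ?thesis by (auto simp: witt_basis_def smul_of_nat)
    qed
  qed
qed

lemma lstar_prod_witt_elem:
  assumes "witt_index n A a" "witt_index n B b"
  shows "lstar_prod n (witt_elem n A a) (witt_elem n B b)
    = (if A \<inter> B = {} then smul (of_nat (witt_coeff a b)) (witt_elem n (A \<union> B) (a + b - 1)) else 0)"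
proof -
  have xL: "xL = Poly_Mapping.single (witt_basis n (n + 1)) 1"
    by (simp add: witt_basis_def)
  have ab: "a \<le> n + 1" "b \<le> n + 1" using assms by (auto simp: witt_index_def split: if_splits)
  have pair_smul: "(smul c (u :: wstar), 0 :: bit) = smul c (u, 0)" for c u
    by (cases c) (simp_all add: zero_prod_def)
  have copy_smul: "copy C (smul c u) = smul c (copy C u)" for C c u
    by (cases c) simp_all
  have single_smul: "Poly_Mapping.single C (smul c u) = smul c (Poly_Mapping.single C u)"
    for C :: "nat set" and c and u :: lvec
    by (cases c) simp_all
  consider "A = {}" "B = {}" | "A = {}" "B \<noteq> {}" | "A \<noteq> {}" "B = {}" | "A \<noteq> {}" "B \<noteq> {}"
    by blast
  then show ?thesis
  proof cases
    case 1
    then show ?thesis using assms even_witt_coeff_self[of a]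
      by (simp add: witt_index_def witt_elem_def xstar_def smul_of_nat zero_prod_def)
  next
    case 2
    have "lstar_prod n xstar (Poly_Mapping.single B (Poly_Mapping.single (witt_basis n b) 1), 0)
       = (copy B (basis_prod n (witt_basis n b) (witt_basis n a)), 0)"
      using assms 2 by (simp add: xstar_def wstar_x_single xL witt_index_def)
    also have "\<dots> = smul (of_nat (witt_coeff a b)) (witt_elem n B (a + b - 1))"
      using 2 basis_prod_witt_basis[OF ab(2) ab(1)]
      by (simp add: single_smul pair_smul witt_elem_def copy_def witt_coeff_commute add.commute)
    finally show ?thesis using 2 by (simp add: witt_elem_def)
  next
    case 3
    have "lstar_prod n (Poly_Mapping.single A (Poly_Mapping.single (witt_basis n a) 1), 0) xstar
       = (copy A (basis_prod n (witt_basis n a) (witt_basis n b)), 0)"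
      using assms 3 by (simp add: xstar_def wstar_x_single xL witt_index_def)
    also have "\<dots> = smul (of_nat (witt_coeff a b)) (witt_elem n A (a + b - 1))"
      using 3 basis_prod_witt_basis[OF ab]
      by (simp add: single_smul pair_smul witt_elem_def copy_def)
    finally show ?thesis using 3 by (simp add: witt_elem_def)
  next
    case 4
    have "lstar_prod n (witt_elem n A a) (witt_elem n B b)
      = (copy (disj_union A B) (basis_prod n (witt_basis n a) (witt_basis n b)), 0)"
      using 4 by (simp add: witt_elem_def wstar_prod_single)
    also have "\<dots> = smul (of_nat (witt_coeff a b))
        (copy (disj_union A B) (Poly_Mapping.single (witt_basis n (a + b - 1)) 1), 0)"
      by (simp only: basis_prod_witt_basis[OF ab] copy_smul pair_smul)
    finally show ?thesis using 4
      by (auto simp: witt_elem_def copy_def disj_union_def simp flip: zero_prod_def)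
  qed
qed

lemma witt_index_prod:
  assumes "witt_index n A a" "witt_index n B b" "A \<inter> B = {}" "odd (witt_coeff a b)"
  shows "witt_index n (A \<union> B) (a + b - 1)"
proof -
  have ab: "a \<le> n + 1" "b \<le> n + 1" using assms by (auto simp: witt_index_def split: if_splits)
  then have "a + b \<le> n + 1" using even_witt_coeff[OF ab] assms(4) by linarith
  then show ?thesis using assms by (auto simp: witt_index_def split: if_splits)
qed

lemma lstar_prod_closed [simp]:
  assumes "y \<in> Lstar n" "z \<in> Lstar n"
  shows "lstar_prod n y z \<in> Lstar n"
  using assms(1)
proof (induction y rule: Lstar_induct)
  case (witt A a)
  from assms(2) show ?case
  proof (induction z rule: Lstar_induct)
    case (witt B b)
    then show ?case using \<open>witt_index n A a\<close> witt_index_prod[of A a B b]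
      by (simp add: lstar_prod_witt_elem smul_of_nat)
  qed (simp_all add: lstar_prod_add)
qed (simp_all add: lstar_prod_add)

lemma lstar_prod_commute:
  assumes "y \<in> Lstar n" "z \<in> Lstar n"
  shows "lstar_prod n y z = lstar_prod n z y"
  using assms(1)
proof (induction y rule: Lstar_induct)
  case (witt A a)
  from assms(2) show ?case
  proof (induction z rule: Lstar_induct)
    case (witt B b)
    then show ?case using \<open>witt_index n A a\<close>
      by (simp add: lstar_prod_witt_elem Int_commute Un_commute add.commute witt_coeff_commute)
  qed (simp_all add: lstar_prod_add)
qed (simp_all add: lstar_prod_add)

text \<open>
  If both coefficients are odd, then the truncated subtractions in the indices are exact, and the
  product of the first two factors is again a basis element.
\<close>
lemma lstar_prod_triple:
  assumes "witt_index n A a" "witt_index n B b" "witt_index n C c"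
  shows "lstar_prod n (lstar_prod n (witt_elem n A a) (witt_elem n B b)) (witt_elem n C c)
    = (if A \<inter> B = {} \<and> A \<inter> C = {} \<and> B \<inter> C = {}
       then smul (of_nat (witt_coeff a b * witt_coeff (a + b - 1) c))
         (witt_elem n (A \<union> B \<union> C) (a + b + c - 2))
       else 0)"
proof (cases "A \<inter> B = {} \<and> odd (witt_coeff a b)")
  case True
  then have "0 < a + b" by (auto simp: witt_coeff_def)
  then have "a + b - 1 + c - 1 = a + b + c - 2" by linarith
  then show ?thesis
    using True assms witt_index_prod[of A a B b]
    by (auto simp: lstar_prod_witt_elem smul_of_nat Int_Un_distrib2 simp del: of_nat_mult)
next
  case False
  then show ?thesis using assms by (auto simp: lstar_prod_witt_elem smul_of_nat)
qed

lemma jacobi: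
  assumes "y \<in> Lstar n" "z \<in> Lstar n" "t \<in> Lstar n"
  shows "lstar_prod n (lstar_prod n y z) t + lstar_prod n (lstar_prod n z t) y
    + lstar_prod n (lstar_prod n t y) z = 0" (is "?J y z t = 0")
  using assms(1)
proof (induction y rule: Lstar_induct)
  case (add y y')
  have "?J (y + y') z t = ?J y z t + ?J y' z t" by (simp add: lstar_prod_add add_ac)
  then show ?case using add by simp
next
  case (witt A a)
  note A = witt
  from assms(2) show ?case
  proof (induction z rule: Lstar_induct)
    case (add z z')
    have "?J y (z + z') t = ?J y z t + ?J y z' t" for y by (simp add: lstar_prod_add add_ac)
    then show ?case using add by simp
  next
    case (witt B b)
    note B = witt
    from assms(3) show ?case
    proof (induction t rule: Lstar_induct)
      case (add t t')
      have "?J y z (t + t') = ?J y z t + ?J y z t'" for y z by (simp add: lstar_prod_add add_ac)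
      then show ?case using add by simp
    next
      case (witt C c)
      let ?k = "witt_coeff a b * witt_coeff (a + b - 1) c + witt_coeff b c * witt_coeff (b + c - 1) a
        + witt_coeff c a * witt_coeff (c + a - 1) b"
      have "?J (witt_elem n A a) (witt_elem n B b) (witt_elem n C c)
        = (if A \<inter> B = {} \<and> A \<inter> C = {} \<and> B \<inter> C = {}
           then smul (of_nat ?k) (witt_elem n (A \<union> B \<union> C) (a + b + c - 2)) else 0)"
        using A B witt
        by (auto simp: lstar_prod_triple Int_commute Un_ac add_ac smul_add_left
          simp del: add_bit_eq_xor of_nat_mult)
      also have "\<dots> = 0"
        using even_witt_coeff_jacobi[of a b c] by (simp only: smul_of_nat) simp
      finally show ?case .
    qed simp
  qed simp
qed simp

end

section \<open>Commutators and normal closures in an arbitrary group\<close>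

text \<open>
  Since \<open>a\<close> and its conjugate \<open>b\<close> are involutions, \<open>[g, a] = b a\<close>, and commuting with \<open>a\<close> squares
  twice (up to inversion): \<open>[g, a, a] = (a b)\<^sup>2\<close> and \<open>[g, a, a, a] = (b a)\<^sup>4\<close>. The hypothesis says that
  \<open>(b a)\<^sup>2\<close> equals its own inverse.
\<close>
lemma (in group) engel_3_if_conjugates_commute:
  assumes a: "a \<in> carrier G" and g: "g \<in> carrier G" and aa: "a \<otimes> a = \<one>"
    and b_def: "b = inv g \<otimes> a \<otimes> g"
    and abab: "a \<otimes> b \<otimes> a \<otimes> b = b \<otimes> a \<otimes> b \<otimes> a"
  shows "commutator G (commutator G (commutator G g a) a) a = \<one>"
proof -
  have b: "b \<in> carrier G" using a g by (simp add: b_def)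
  have inv_a: "inv a = a" using a aa by (intro inv_equality) auto
  have aa': "a \<otimes> (a \<otimes> c) = c" if "c \<in> carrier G" for c
    using that a aa by (simp flip: m_assoc)
  have inv_b: "inv b = b"
    using a g by (simp add: b_def inv_mult_group inv_a m_assoc)
  have bb': "b \<otimes> (b \<otimes> c) = c" if "c \<in> carrier G" for c
    using that b inv_b by (metis l_inv m_assoc l_one)
  note [simp] = a b m_assoc aa aa' bb' inv_a inv_b inv_mult_group
  have 1: "commutator G g a = b \<otimes> a"
    using g by (simp add: commutator_def b_def)
  have 2: "commutator G (b \<otimes> a) a = a \<otimes> b \<otimes> a \<otimes> b"
    by (simp add: commutator_def)
  have "commutator G (a \<otimes> b \<otimes> a \<otimes> b) a = (b \<otimes> a \<otimes> b \<otimes> a) \<otimes> (b \<otimes> a \<otimes> b \<otimes> a)"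
    by (simp add: commutator_def)
  also have "\<dots> = (b \<otimes> a \<otimes> b \<otimes> a) \<otimes> (a \<otimes> b \<otimes> a \<otimes> b)"
    by (simp only: abab)
  also have "\<dots> = \<one>" using b inv_b l_inv[OF b] by simp
  finally show ?thesis unfolding 1 2 .
qed

lemma (in group) commutator_involutions:
  assumes "a \<in> carrier G" "b \<in> carrier G" "a \<otimes> a = \<one>" "b \<otimes> b = \<one>"
  shows "commutator G a b = a \<otimes> b \<otimes> a \<otimes> b"
  using assms inv_equality[of a a] inv_equality[of b b] by (simp add: commutator_def)

lemma (in group) normal_closure_normal:
  assumes "S \<subseteq> carrier G"
  shows "normal_closure G S \<lhd> G"
  unfolding normal_closure_def
proof (rule normal_generateI)
  show "{inv g \<otimes> s \<otimes> g |g s. g \<in> carrier G \<and> s \<in> S} \<subseteq> carrier G"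
    using assms by auto
next
  fix h g assume "h \<in> {inv g \<otimes> s \<otimes> g |g s. g \<in> carrier G \<and> s \<in> S}" and g: "g \<in> carrier G"
  then obtain k s where k: "k \<in> carrier G" and s: "s \<in> S" and h: "h = inv k \<otimes> s \<otimes> k" by blast
  have "g \<otimes> h \<otimes> inv g = inv (k \<otimes> inv g) \<otimes> s \<otimes> (k \<otimes> inv g)"
    using g k s assms by (simp add: h m_assoc inv_mult_group subset_iff)
  then show "g \<otimes> h \<otimes> inv g \<in> {inv g \<otimes> s \<otimes> g |g s. g \<in> carrier G \<and> s \<in> S}"
    using g k s by blast
qed

lemma (in group) normal_closure_incl:
  assumes "s \<in> S" "s \<in> carrier G"
  shows "s \<in> normal_closure G S"
  unfolding normal_closure_def
proof (rule generate.incl)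
  have "s = inv \<one> \<otimes> s \<otimes> \<one>" using assms by simp
  then show "s \<in> {inv g \<otimes> s \<otimes> g |g s. g \<in> carrier G \<and> s \<in> S}" using assms by blast
qed

section \<open>The general linear group and the automorphisms of \<open>L\<^sup>*\<close>\<close>

lemma GL_carrier: "f \<in> carrier (GL_Lstar n) \<longleftrightarrow> f \<in> Bij (Lstar n) \<and> linear_on_Lstar n f"
  by (simp add: GL_Lstar_def)

lemma GL_one: "\<one>\<^bsub>GL_Lstar n\<^esub> = (\<lambda>z\<in>Lstar n. z)"
  by (simp add: GL_Lstar_def)

lemma GL_mult: "f \<otimes>\<^bsub>GL_Lstar n\<^esub> g = compose (Lstar n) g f"
  by (simp add: GL_Lstar_def)

lemma GL_mult_apply: "z \<in> Lstar n \<Longrightarrow> (f \<otimes>\<^bsub>GL_Lstar n\<^esub> g) z = g (f z)"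
  by (simp add: GL_mult compose_def)

lemma GL_apply_closed: "f \<in> carrier (GL_Lstar n) \<Longrightarrow> z \<in> Lstar n \<Longrightarrow> f z \<in> Lstar n"
  unfolding GL_carrier using Bij_imp_funcset funcset_mem by metis

lemma GL_add:
  "f \<in> carrier (GL_Lstar n) \<Longrightarrow> y \<in> Lstar n \<Longrightarrow> z \<in> Lstar n \<Longrightarrow> f (y + z) = f y + f z"
  by (simp add: GL_carrier linear_on_Lstar_def)

lemma GL_surj:
  assumes "f \<in> carrier (GL_Lstar n)" "z \<in> Lstar n"
  obtains y where "y \<in> Lstar n" "z = f y"
proof -
  have "z \<in> f ` Lstar n" using assms by (simp add: GL_carrier Bij_def bij_betw_def)
  then show ?thesis using that by blast
qed

lemma GL_eqI:
  assumes "f \<in> carrier (GL_Lstar n)" "g \<in> carrier (GL_Lstar n)"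
    and "\<And>z. z \<in> Lstar n \<Longrightarrow> f z = g z"
  shows "f = g"
proof (rule extensionalityI)
  show "f \<in> extensional (Lstar n)" "g \<in> extensional (Lstar n)"
    using assms by (simp_all add: GL_carrier Bij_imp_extensional)
qed (rule assms(3))

lemma linear_on_LstarI:
  assumes "\<And>y z. y \<in> Lstar n \<Longrightarrow> z \<in> Lstar n \<Longrightarrow> f (y + z) = f y + f z"
  shows "linear_on_Lstar n f"
proof -
  have "f (0 + 0) = f 0 + f 0" by (intro assms) simp_all
  then have f0: "f 0 = 0" by simp
  have "f (smul c z) = smul c (f z)" if "z \<in> Lstar n" for c z
    by (cases c) (simp_all add: f0)
  then show ?thesis using assms by (simp add: linear_on_Lstar_def)
qed

lemma GL_inverse:
  assumes "f \<in> carrier (GL_Lstar n)"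
  defines "g \<equiv> restrict (inv_into (Lstar n) f) (Lstar n)"
  shows "g \<in> carrier (GL_Lstar n)" "g \<otimes>\<^bsub>GL_Lstar n\<^esub> f = \<one>\<^bsub>GL_Lstar n\<^esub>"
proof -
  have f: "f \<in> Bij (Lstar n)" using assms by (simp add: GL_carrier)
  have "linear_on_Lstar n g"
  proof (rule linear_on_LstarI)
    fix y z assume "y \<in> Lstar n" "z \<in> Lstar n"
    then show "g (y + z) = g y + g z"
      using Bij_inv_into_lemma[of "Lstar n" f "(+)" y z] f GL_add[OF assms(1)]
      by (simp add: g_def)
  qed
  then show "g \<in> carrier (GL_Lstar n)"
    using restrict_inv_into_Bij[OF f] by (simp add: GL_carrier g_def)
  show "g \<otimes>\<^bsub>GL_Lstar n\<^esub> f = \<one>\<^bsub>GL_Lstar n\<^esub>"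
  proof
    fix z
    show "(g \<otimes>\<^bsub>GL_Lstar n\<^esub> f) z = \<one>\<^bsub>GL_Lstar n\<^esub> z"
      using f by (simp add: GL_mult GL_one g_def compose_def Bij_def bij_betw_def f_inv_into_f)
  qed
qed

lemma group_GL: "group (GL_Lstar n)"
proof (rule groupI)
  fix f g assume fg: "f \<in> carrier (GL_Lstar n)" "g \<in> carrier (GL_Lstar n)"
  have "linear_on_Lstar n (compose (Lstar n) g f)"
    using fg by (intro linear_on_LstarI) (simp add: compose_eq GL_add GL_apply_closed)
  then show "f \<otimes>\<^bsub>GL_Lstar n\<^esub> g \<in> carrier (GL_Lstar n)"
    using fg compose_Bij[of g "Lstar n" f] by (simp add: GL_mult GL_carrier)
next
  have "linear_on_Lstar n (\<lambda>z\<in>Lstar n. z)" by (rule linear_on_LstarI) simp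
  then show "\<one>\<^bsub>GL_Lstar n\<^esub> \<in> carrier (GL_Lstar n)"
    using id_Bij[of "Lstar n"] by (simp add: GL_one GL_carrier)
next
  fix f g h assume "f \<in> carrier (GL_Lstar n)" "g \<in> carrier (GL_Lstar n)" "h \<in> carrier (GL_Lstar n)"
  then show "f \<otimes>\<^bsub>GL_Lstar n\<^esub> g \<otimes>\<^bsub>GL_Lstar n\<^esub> h = f \<otimes>\<^bsub>GL_Lstar n\<^esub> (g \<otimes>\<^bsub>GL_Lstar n\<^esub> h)"
    by (simp add: GL_mult GL_carrier Bij_imp_funcset compose_assoc)
next
  fix f assume f: "f \<in> carrier (GL_Lstar n)"
  then show "\<one>\<^bsub>GL_Lstar n\<^esub> \<otimes>\<^bsub>GL_Lstar n\<^esub> f = f"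
    using compose_Id[of f "Lstar n" "Lstar n"]
    by (simp add: GL_mult GL_one GL_carrier Bij_imp_funcset Bij_imp_extensional)
  show "\<exists>g\<in>carrier (GL_Lstar n). g \<otimes>\<^bsub>GL_Lstar n\<^esub> f = \<one>\<^bsub>GL_Lstar n\<^esub>"
    using GL_inverse[OF f] by blast
qed

lemma one_plus_ad_apply: "z \<in> Lstar n \<Longrightarrow> one_plus_ad n y z = z + lstar_prod n z y"
  by (simp add: one_plus_ad_def ad_def)

definition lie_aut :: "nat \<Rightarrow> (lstar \<Rightarrow> lstar) set" where
  "lie_aut n = {f \<in> carrier (GL_Lstar n).
     \<forall>y\<in>Lstar n. \<forall>z\<in>Lstar n. f (lstar_prod n y z) = lstar_prod n (f y) (f z)}"

lemma lie_autI:
  assumes "f \<in> carrier (GL_Lstar n)"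
    and "\<And>y z. y \<in> Lstar n \<Longrightarrow> z \<in> Lstar n \<Longrightarrow> f (lstar_prod n y z) = lstar_prod n (f y) (f z)"
  shows "f \<in> lie_aut n"
  using assms unfolding lie_aut_def by blast

lemma lie_aut_GL [simp]: "f \<in> lie_aut n \<Longrightarrow> f \<in> carrier (GL_Lstar n)"
  unfolding lie_aut_def by blast

lemma lie_aut_prod:
  "f \<in> lie_aut n \<Longrightarrow> y \<in> Lstar n \<Longrightarrow> z \<in> Lstar n
    \<Longrightarrow> f (lstar_prod n y z) = lstar_prod n (f y) (f z)"
  unfolding lie_aut_def by blast

text \<open>
  These conditions make \<open>1 + ad(y)\<close> the exponential of a nilpotent derivation: an involution that
  preserves products. In characteristic 2 the condition \<open>ad(y)\<^sup>2 = 0\<close> gives no information about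
  \<open>(s \<cdot> y) \<cdot> (t \<cdot> y)\<close>, which occurs with coefficient 2 in \<open>((s \<cdot> t) \<cdot> y) \<cdot> y\<close>.
\<close>
definition exponentiable :: "nat \<Rightarrow> lstar \<Rightarrow> bool" where
  "exponentiable n y \<longleftrightarrow> y \<in> Lstar n \<and>
     (\<forall>s\<in>Lstar n. lstar_prod n (lstar_prod n s y) y = 0) \<and>
     (\<forall>s\<in>Lstar n. \<forall>t\<in>Lstar n. lstar_prod n (lstar_prod n s y) (lstar_prod n t y) = 0)"

lemma exponentiable_Lstar [simp]: "exponentiable n y \<Longrightarrow> y \<in> Lstar n"
  unfolding exponentiable_def by blast

lemma exponentiable_square:
  "exponentiable n y \<Longrightarrow> s \<in> Lstar n \<Longrightarrow> lstar_prod n (lstar_prod n s y) y = 0"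
  unfolding exponentiable_def by blast

lemma exponentiable_prod:
  "exponentiable n y \<Longrightarrow> s \<in> Lstar n \<Longrightarrow> t \<in> Lstar n
    \<Longrightarrow> lstar_prod n (lstar_prod n s y) (lstar_prod n t y) = 0"
  unfolding exponentiable_def by blast

context witt_parameters
begin

lemma exponentiable_image:
  assumes g: "g \<in> lie_aut n" and y: "exponentiable n y"
  shows "exponentiable n (g y)"
proof -
  have prod: "lstar_prod n (g s) (g y) = g (lstar_prod n s y)" if "s \<in> Lstar n" for s
    using lie_aut_prod[OF g that] y by simp
  have g0: "g 0 = 0" using GL_add[of g n 0 0] g by simp
  show ?thesis
    unfolding exponentiable_def
  proof (intro conjI ballI)
    show "g y \<in> Lstar n" using g y by (simp add: GL_apply_closed)
  next
    fix s assume "s \<in> Lstar n"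
    then obtain s' where s': "s' \<in> Lstar n" "s = g s'" using GL_surj g lie_aut_GL by metis
    have "lstar_prod n (lstar_prod n s (g y)) (g y) = g (lstar_prod n (lstar_prod n s' y) y)"
      using s' y lie_aut_prod[OF g, of "lstar_prod n s' y" y] by (simp add: prod)
    then show "lstar_prod n (lstar_prod n s (g y)) (g y) = 0"
      using s' y by (simp add: exponentiable_square g0)
  next
    fix s t assume "s \<in> Lstar n" "t \<in> Lstar n"
    then obtain s' t' where s': "s' \<in> Lstar n" "s = g s'" "t' \<in> Lstar n" "t = g t'"
      using GL_surj g lie_aut_GL by metis
    have "lstar_prod n (lstar_prod n s (g y)) (lstar_prod n t (g y))
        = g (lstar_prod n (lstar_prod n s' y) (lstar_prod n t' y))"
      using s' y lie_aut_prod[OF g, of "lstar_prod n s' y" "lstar_prod n t' y"]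
      by (simp add: prod)
    then show "lstar_prod n (lstar_prod n s (g y)) (lstar_prod n t (g y)) = 0"
      using s' y by (simp add: exponentiable_prod g0)
  qed
qed

lemma subgroup_lie_aut: "subgroup (lie_aut n) (GL_Lstar n)"
proof -
  interpret GL: group "GL_Lstar n" by (rule group_GL)
  show ?thesis
  proof (rule GL.subgroupI)
    show "lie_aut n \<subseteq> carrier (GL_Lstar n)" by auto
    have "\<one>\<^bsub>GL_Lstar n\<^esub> \<in> lie_aut n"
      by (rule lie_autI) (rule GL.one_closed, simp add: GL_one)
    then show "lie_aut n \<noteq> {}" by blast
  next
    fix f assume f: "f \<in> lie_aut n"
    let ?g = "restrict (inv_into (Lstar n) f) (Lstar n)"
    have "inv\<^bsub>GL_Lstar n\<^esub> f = ?g"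
      using f GL_inverse[of f n] by (intro GL.inv_equality) auto
    moreover have "?g \<in> lie_aut n"
    proof -
      have "inv_into (Lstar n) f (lstar_prod n y z)
          = lstar_prod n (inv_into (Lstar n) f y) (inv_into (Lstar n) f z)"
        if "y \<in> Lstar n" "z \<in> Lstar n" for y z
      proof (rule Bij_inv_into_lemma[of "Lstar n" f "lstar_prod n"])
        show "f \<in> Bij (Lstar n)" using lie_aut_GL[OF f] by (simp add: GL_carrier)
        show "lstar_prod n \<in> Lstar n \<rightarrow> Lstar n \<rightarrow> Lstar n" by (intro funcsetI lstar_prod_closed)
      qed (rule lie_aut_prod[OF f] that; assumption)+
      then show ?thesis
        by (intro lie_autI GL_inverse(1) lie_aut_GL[OF f]) simp
    qed
    ultimately show "inv\<^bsub>GL_Lstar n\<^esub> f \<in> lie_aut n" by simp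
  next
    fix f g assume "f \<in> lie_aut n" "g \<in> lie_aut n"
    then show "f \<otimes>\<^bsub>GL_Lstar n\<^esub> g \<in> lie_aut n"
      by (intro lie_autI) (simp_all add: GL_mult_apply GL_apply_closed lie_aut_prod)
  qed
qed

lemma one_plus_ad_involution:
  assumes y: "exponentiable n y" and z: "z \<in> Lstar n"
  shows "one_plus_ad n y (one_plus_ad n y z) = z"
  using y z by (simp add: one_plus_ad_apply lstar_prod_add exponentiable_square add.assoc)

text \<open>
  By the Jacobi identity \<open>ad(y)\<close> is a derivation, and the error term \<open>(s \<cdot> y) \<cdot> (t \<cdot> y)\<close> in the product of
  the images of \<open>s\<close> and \<open>t\<close> vanishes.
\<close>
lemma one_plus_ad_lie_aut:
  assumes y: "exponentiable n y"
  shows "one_plus_ad n y \<in> lie_aut n"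
proof -
  have L: "y \<in> Lstar n" using y by simp
  have closed: "one_plus_ad n y z \<in> Lstar n" if "z \<in> Lstar n" for z
    using L that by (simp add: one_plus_ad_apply)
  have "bij_betw (one_plus_ad n y) (Lstar n) (Lstar n)"
    using closed one_plus_ad_involution[OF y]
    by (intro bij_betw_byWitness[where f' = "one_plus_ad n y"]) auto
  moreover have "one_plus_ad n y \<in> extensional (Lstar n)"
    by (simp add: one_plus_ad_def)
  moreover have "linear_on_Lstar n (one_plus_ad n y)"
    by (rule linear_on_LstarI) (simp add: one_plus_ad_apply lstar_prod_add add_ac)
  ultimately have GL: "one_plus_ad n y \<in> carrier (GL_Lstar n)"
    by (simp add: GL_carrier Bij_def)
  have "one_plus_ad n y (lstar_prod n s t)
      = lstar_prod n (one_plus_ad n y s) (one_plus_ad n y t)"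
    if s: "s \<in> Lstar n" and t: "t \<in> Lstar n" for s t
  proof -
    have "lstar_prod n (lstar_prod n s t) y
        = lstar_prod n (lstar_prod n t y) s + lstar_prod n (lstar_prod n y s) t"
      using jacobi[OF s t L] by (simp only: add.assoc char2_add_eq_0_iff)
    also have "\<dots> = lstar_prod n s (lstar_prod n t y) + lstar_prod n (lstar_prod n s y) t"
      using s t L lstar_prod_commute[of "lstar_prod n t y" s] lstar_prod_commute[of y s] by simp
    finally show ?thesis
      using s t L exponentiable_prod[OF y s t]
      by (simp add: one_plus_ad_apply lstar_prod_add add_ac)
  qed
  with GL show ?thesis by (rule lie_autI)
qed

lemma one_plus_ad_GL [simp]: "exponentiable n y \<Longrightarrow> one_plus_ad n y \<in> carrier (GL_Lstar n)"
  by (simp add: one_plus_ad_lie_aut)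

lemma one_plus_ad_square:
  assumes "exponentiable n y"
  shows "one_plus_ad n y \<otimes>\<^bsub>GL_Lstar n\<^esub> one_plus_ad n y = \<one>\<^bsub>GL_Lstar n\<^esub>"
  using one_plus_ad_involution[OF assms]
  by (auto simp: GL_mult GL_one compose_def)

lemma conj_one_plus_ad:
  assumes g: "g \<in> lie_aut n" and y: "exponentiable n y"
  shows "inv\<^bsub>GL_Lstar n\<^esub> g \<otimes>\<^bsub>GL_Lstar n\<^esub> one_plus_ad n y \<otimes>\<^bsub>GL_Lstar n\<^esub> g = one_plus_ad n (g y)"
proof -
  interpret GL: group "GL_Lstar n" by (rule group_GL)
  note [simp] = g y exponentiable_image[OF g y]
  have "one_plus_ad n y \<otimes>\<^bsub>GL_Lstar n\<^esub> g = g \<otimes>\<^bsub>GL_Lstar n\<^esub> one_plus_ad n (g y)"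
    by (rule GL_eqI[of _ n])
      (simp_all add: GL_mult_apply one_plus_ad_apply GL_add[OF lie_aut_GL[OF g]] GL_apply_closed
        lie_aut_prod[OF g])
  then show ?thesis
    by (simp add: GL.m_assoc) (simp flip: GL.m_assoc)
qed

text \<open>
  Conjugating by \<open>1 + ad(z)\<close> replaces \<open>y\<close> by \<open>y + y \<cdot> z\<close>, so the commutator is
  \<open>(1 + ad(y)) (1 + ad(y) + ad(y \<cdot> z))\<close>. Here \<open>ad(y)\<^sup>2 = 0\<close>, and \<open>ad(y) ad(y \<cdot> z) = 0\<close> because
  \<open>y \<cdot> z = z \<cdot> y\<close> is itself an image of \<open>ad(y)\<close>.
\<close>
lemma commutator_one_plus_ad:
  assumes y: "exponentiable n y" and z: "exponentiable n z"
  shows "one_plus_ad n y \<otimes>\<^bsub>GL_Lstar n\<^esub> one_plus_ad n z \<otimes>\<^bsub>GL_Lstar n\<^esub> one_plus_ad n y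
     \<otimes>\<^bsub>GL_Lstar n\<^esub> one_plus_ad n z = one_plus_ad n (lstar_prod n y z)"
proof -
  interpret GL: group "GL_Lstar n" by (rule group_GL)
  let ?P = "one_plus_ad n"
  let ?y' = "y + lstar_prod n y z"
  have inv_z: "inv\<^bsub>GL_Lstar n\<^esub> (?P z) = ?P z"
    using z one_plus_ad_square by (intro GL.inv_equality) auto
  have "?P z \<otimes>\<^bsub>GL_Lstar n\<^esub> ?P y \<otimes>\<^bsub>GL_Lstar n\<^esub> ?P z = ?P ?y'"
    using conj_one_plus_ad[OF one_plus_ad_lie_aut[OF z] y] y
    by (simp add: inv_z one_plus_ad_apply)
  then have "?P y \<otimes>\<^bsub>GL_Lstar n\<^esub> ?P z \<otimes>\<^bsub>GL_Lstar n\<^esub> ?P y \<otimes>\<^bsub>GL_Lstar n\<^esub> ?P z = ?P y \<otimes>\<^bsub>GL_Lstar n\<^esub> ?P ?y'"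
    using y z by (simp add: GL.m_assoc)
  also have "\<dots> = ?P (lstar_prod n y z)"
  proof
    fix t
    show "(?P y \<otimes>\<^bsub>GL_Lstar n\<^esub> ?P ?y') t = ?P (lstar_prod n y z) t"
    proof (cases "t \<in> Lstar n")
      case True
      have "lstar_prod n (lstar_prod n t y) (lstar_prod n y z) = 0"
        using exponentiable_prod[OF y True, of z] lstar_prod_commute[of y z] y z by simp
      then show ?thesis using True y z
        by (simp add: GL_mult_apply one_plus_ad_apply lstar_prod_add exponentiable_square add_ac)
    qed (simp add: GL_mult compose_def one_plus_ad_def)
  qed
  finally show ?thesis .
qed

lemma xstar_witt_elem: "xstar = witt_elem n {} (n + 1)"
  by (simp add: witt_elem_def)

lemma witt_elem_xstar:
  assumes "witt_index n A a"
  shows "lstar_prod n (witt_elem n A a) xstar = (if a = 0 then witt_elem n A n else 0)"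
proof -
  have a: "a \<le> n + 1" using assms by (auto simp: witt_index_def split: if_splits)
  have "lstar_prod n (witt_elem n A a) xstar
      = smul (of_nat (witt_coeff a (n + 1))) (witt_elem n A (a + n))"
    using lstar_prod_witt_elem[OF assms, of "{}" "n + 1"]
    by (simp add: xstar_witt_elem witt_index_def)
  then show ?thesis using even_witt_coeff[OF a, of "n + 1"]
    by (auto simp: smul_of_nat witt_coeff_def)
qed

lemma witt_elem_n_n:
  assumes "witt_index n A n" "witt_index n B n"
  shows "lstar_prod n (witt_elem n A n) (witt_elem n B n) = 0"
  using lstar_prod_witt_elem[OF assms] even_witt_coeff_self[of n] by (simp add: smul_of_nat)

text \<open>
  For \<open>A \<noteq> \<emptyset>\<close> the label \<open>A\<close> would occur twice in every product in question. For \<open>x\<close>, the image of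
  \<open>ad(x)\<close> is spanned by the \<open>(f\<^sub>n)\<^sub>B = v(0)\<^sub>B\<close>, which multiply to zero among themselves and with \<open>x\<close>.
\<close>
lemma exponentiable_witt_elem:
  assumes A: "witt_index n A a"
  shows "exponentiable n (witt_elem n A a)"
  unfolding exponentiable_def
proof (intro conjI ballI)
  show "witt_elem n A a \<in> Lstar n" using A by simp
next
  have n0: "n \<noteq> 0" using two_le_n by simp
  fix s assume s: "s \<in> Lstar n"
  then show "lstar_prod n (lstar_prod n s (witt_elem n A a)) (witt_elem n A a) = 0"
  proof (induction s rule: Lstar_induct)
    case (witt B b)
    show ?case
    proof (cases "A = {}")
      case True
      then have x: "witt_elem n A a = xstar" by (simp add: witt_elem_def)
      have "b = 0 \<Longrightarrow> witt_index n B n" using witt by (auto simp: witt_index_def split: if_splits)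
      then show ?thesis using witt n0 by (simp add: x witt_elem_xstar)
    next
      case False
      then show ?thesis using A witt by (simp add: lstar_prod_triple)
    qed
  qed (simp_all add: lstar_prod_add)
  fix t assume "t \<in> Lstar n"
  from s show "lstar_prod n (lstar_prod n s (witt_elem n A a)) (lstar_prod n t (witt_elem n A a)) = 0"
  proof (induction s rule: Lstar_induct)
    case (witt B b)
    note B = witt
    from \<open>t \<in> Lstar n\<close> show ?case
    proof (induction t rule: Lstar_induct)
      case (witt C c)
      show ?case
      proof (cases "A = {}")
        case True
        then have x: "witt_elem n A a = xstar" by (simp add: witt_elem_def)
        have "b = 0 \<Longrightarrow> witt_index n B n" "c = 0 \<Longrightarrow> witt_index n C n"
          using witt B by (auto simp: witt_index_def split: if_splits)
        then show ?thesis using witt B by (simp add: x witt_elem_xstar witt_elem_n_n)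
      next
        case False
        then show ?thesis
          using A B witt witt_index_prod[of B b A a] witt_index_prod[of C c A a]
          by (auto simp: lstar_prod_witt_elem smul_of_nat)
      qed
    qed (simp_all add: lstar_prod_add)
  qed (simp_all add: lstar_prod_add)
qed

text \<open>
  The operator \<open>ad(x)\<close> sees only the components along \<open>f\<^sub>0 = w\<close> and maps them to multiples of \<open>f\<^sub>n\<close>. A product
  \<open>f\<^sub>n \<cdot> f\<^sub>b\<close> has index \<open>n + b - 1 > 0\<close>, so nothing is left for the second application.
\<close>
lemma xstar_sandwich:
  assumes "z \<in> Lstar n" "y \<in> Lstar n"
  shows "lstar_prod n (lstar_prod n (lstar_prod n z xstar) y) xstar = 0"
  using assms(1)
proof (induction z rule: Lstar_induct)
  case (witt A a)
  note A = witt
  from assms(2) show ?case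
  proof (induction y rule: Lstar_induct)
    case (witt B b)
    show ?case
    proof (cases "a = 0")
      case True
      then have A': "witt_index n A n" using A by (auto simp: witt_index_def split: if_splits)
      have "lstar_prod n (lstar_prod n (witt_elem n A n) (witt_elem n B b)) xstar = 0"
        using A' witt witt_index_prod[of A n B b] two_le_n
        by (auto simp: lstar_prod_witt_elem smul_of_nat witt_elem_xstar)
      with A True show ?thesis by (simp add: witt_elem_xstar)
    qed (use A in \<open>simp add: witt_elem_xstar\<close>)
  qed (simp_all add: lstar_prod_add)
qed (simp_all add: lstar_prod_add)

end

section \<open>The group \<open>G\<close> and the Engel property\<close>

lemma infinite_halves:
  assumes "infinite (A :: 'a set)"
  obtains B C where "infinite B" "infinite C" "B \<inter> C = {}" "B \<union> C = A"
proof -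
  obtain D :: "nat \<Rightarrow> 'a set" where D: "pairwise (\<lambda>i j. disjnt (D i) (D j)) UNIV"
    "(\<Union>i. D i) \<subseteq> A" "\<And>i. infinite (D i)"
    by (rule infinite_infinite_partition[OF assms]) (rule that; assumption)
  have "disjnt (D 0) (D 1)" using pairwiseD[OF D(1), of 0 1] by simp
  then have "D 1 \<subseteq> A - D 0" using D(2) by (auto simp: disjnt_def)
  then have "infinite (A - D 0)" using D(3) finite_subset by blast
  moreover have "D 0 \<union> (A - D 0) = A" using D(2) by blast
  ultimately show ?thesis using that[of "D 0" "A - D 0"] D(3) by blast
qed

context witt_parameters
begin

definition G_generators :: "(lstar \<Rightarrow> lstar) set" where
  "G_generators = {one_plus_ad n xstar} \<union> (\<Union>i<n. V_group n i) \<union> W_group n"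

lemma G_group_eq: "G_group n = (GL_Lstar n)\<lparr>carrier := generate (GL_Lstar n) G_generators\<rparr>"
  by (simp add: G_group_def G_generators_def)

lemma exponentiable_0: "exponentiable n 0"
  unfolding exponentiable_def by (intro conjI ballI) simp_all

lemma exponentiable_xstar: "exponentiable n xstar"
  unfolding xstar_witt_elem by (rule exponentiable_witt_elem) (simp add: witt_index_def)

lemma vstar_eq: "i < n \<Longrightarrow> A \<noteq> {} \<Longrightarrow> vstar i A = witt_elem n A (n - i)"
  by (auto simp: vstar_def copy_def witt_elem_def witt_basis_def)

lemma wwstar_eq: "A \<noteq> {} \<Longrightarrow> wwstar A = witt_elem n A 0"
  by (simp add: wwstar_def copy_def witt_elem_def witt_basis_def)

lemma exponentiable_vstar:
  assumes "i < n"
  shows "exponentiable n (vstar i A)"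
proof (cases "A = {}")
  case True
  then have "vstar i A = 0" by (simp add: vstar_def copy_def zero_prod_def)
  then show ?thesis using exponentiable_0 by simp
next
  case False
  with assms show ?thesis by (auto simp: vstar_eq witt_index_def intro: exponentiable_witt_elem)
qed

lemma exponentiable_wwstar: "exponentiable n (wwstar A)"
proof (cases "A = {}")
  case True
  then have "wwstar A = 0" by (simp add: wwstar_def copy_def zero_prod_def)
  then show ?thesis using exponentiable_0 by simp
next
  case False
  then show ?thesis by (auto simp: wwstar_eq witt_index_def intro: exponentiable_witt_elem)
qed

lemma G_generators_lie_aut: "G_generators \<subseteq> lie_aut n"
proof -
  interpret GL: group "GL_Lstar n" by (rule group_GL)
  have "V_group n i \<subseteq> lie_aut n" if "i < n" for i
    unfolding V_group_def using that exponentiable_vstar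
    by (intro GL.generate_subgroup_incl subgroup_lie_aut) (auto intro: one_plus_ad_lie_aut)
  moreover have "W_group n \<subseteq> lie_aut n"
    unfolding W_group_def using exponentiable_wwstar
    by (intro GL.generate_subgroup_incl subgroup_lie_aut) (auto intro: one_plus_ad_lie_aut)
  ultimately show ?thesis
    using one_plus_ad_lie_aut[OF exponentiable_xstar] by (auto simp: G_generators_def)
qed

lemma subgroup_G: "subgroup (carrier (G_group n)) (GL_Lstar n)"
proof -
  interpret GL: group "GL_Lstar n" by (rule group_GL)
  show ?thesis
    using G_generators_lie_aut by (auto simp: G_group_eq intro!: GL.generate_is_subgroup)
qed

lemma G_carrier_lie_aut: "carrier (G_group n) \<subseteq> lie_aut n"
proof -
  interpret GL: group "GL_Lstar n" by (rule group_GL)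
  show ?thesis
    using GL.generate_subgroup_incl[OF G_generators_lie_aut subgroup_lie_aut]
    by (simp add: G_group_eq)
qed

lemma G_group_subset: "G_group n = (GL_Lstar n)\<lparr>carrier := carrier (G_group n)\<rparr>"
  by (simp add: G_group_eq)

lemma group_G: "group (G_group n)"
  using subgroup.subgroup_is_group[OF subgroup_G group_GL] G_group_subset by simp

lemma G_mult [simp]: "f \<otimes>\<^bsub>G_group n\<^esub> g = f \<otimes>\<^bsub>GL_Lstar n\<^esub> g"
  and G_one [simp]: "\<one>\<^bsub>G_group n\<^esub> = \<one>\<^bsub>GL_Lstar n\<^esub>"
  by (simp_all add: G_group_eq)

lemma G_inv: "f \<in> carrier (G_group n) \<Longrightarrow> inv\<^bsub>G_group n\<^esub> f = inv\<^bsub>GL_Lstar n\<^esub> f"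
  using group.m_inv_consistent[OF group_GL subgroup_G] G_group_subset by metis

lemma one_plus_ad_xstar_G: "one_plus_ad n xstar \<in> carrier (G_group n)"
  by (auto simp: G_group_eq G_generators_def intro: generate.incl)

lemma one_plus_ad_wwstar_G: "one_plus_ad n (wwstar A) \<in> carrier (G_group n)"
  by (auto simp: G_group_eq G_generators_def W_group_def intro!: generate.incl)

text \<open>
  Both sides expand to \<open>1 + X Y + Y X + Y X Y\<close> with \<open>X = ad(x)\<close> and \<open>Y = ad(y)\<close>: words containing
  \<open>X X\<close>, \<open>Y Y\<close> or \<open>X Y X\<close> vanish, and the terms that occur twice cancel.
\<close>
lemma one_plus_ad_xstar_alternating:
  assumes y: "exponentiable n y"
  defines "a \<equiv> one_plus_ad n xstar" and "b \<equiv> one_plus_ad n y"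
  shows "a \<otimes>\<^bsub>GL_Lstar n\<^esub> b \<otimes>\<^bsub>GL_Lstar n\<^esub> a \<otimes>\<^bsub>GL_Lstar n\<^esub> b
    = b \<otimes>\<^bsub>GL_Lstar n\<^esub> a \<otimes>\<^bsub>GL_Lstar n\<^esub> b \<otimes>\<^bsub>GL_Lstar n\<^esub> a"
proof -
  interpret GL: group "GL_Lstar n" by (rule group_GL)
  have [simp]: "a \<in> carrier (GL_Lstar n)" "b \<in> carrier (GL_Lstar n)"
    using y exponentiable_xstar by (simp_all add: a_def b_def)
  have [simp]: "y \<in> Lstar n" "xstar \<in> Lstar n" using y exponentiable_xstar by simp_all
  show ?thesis
    by (rule GL_eqI[of _ n])
      (simp_all add: GL_mult_apply GL_apply_closed, simp add: a_def b_def one_plus_ad_apply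
        lstar_prod_add exponentiable_square[OF y] exponentiable_square[OF exponentiable_xstar]
        xstar_sandwich add_ac)
qed

lemma left_3_engel_one_plus_ad_xstar: "left_3_engel (G_group n) (one_plus_ad n xstar)"
  unfolding left_3_engel_def
proof (intro conjI ballI one_plus_ad_xstar_G)
  interpret G: group "G_group n" by (rule group_G)
  let ?a = "one_plus_ad n xstar"
  fix g assume g: "g \<in> carrier (G_group n)"
  then have gA: "g \<in> lie_aut n" using G_carrier_lie_aut by blast
  let ?b = "one_plus_ad n (g xstar)"
  have b: "?b = inv\<^bsub>G_group n\<^esub> g \<otimes>\<^bsub>G_group n\<^esub> ?a \<otimes>\<^bsub>G_group n\<^esub> g"
    using conj_one_plus_ad[OF gA exponentiable_xstar] by (simp add: G_inv[OF g])
  show "commutator (G_group n) (commutator (G_group n) (commutator (G_group n) g ?a) ?a) ?a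
      = \<one>\<^bsub>G_group n\<^esub>"
    by (rule G.engel_3_if_conjugates_commute[OF one_plus_ad_xstar_G g _ b])
      (simp_all add: one_plus_ad_square[OF exponentiable_xstar]
        one_plus_ad_xstar_alternating[OF exponentiable_image[OF gA exponentiable_xstar]])
qed

section \<open>The normal closure of \<open>1 + ad(x)\<close>\<close>

definition x_closure :: "(lstar \<Rightarrow> lstar) set" where
  "x_closure = normal_closure (G_group n) {one_plus_ad n xstar}"

lemma normal_x_closure: "x_closure \<lhd> G_group n"
  unfolding x_closure_def
  by (rule group.normal_closure_normal[OF group_G]) (simp add: one_plus_ad_xstar_G)

lemma x_closure_xstar: "one_plus_ad n xstar \<in> x_closure"
  unfolding x_closure_def
  by (rule group.normal_closure_incl[OF group_G]) (simp_all add: one_plus_ad_xstar_G)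

lemma x_closure_prod:
  assumes y: "exponentiable n y" "one_plus_ad n y \<in> x_closure"
    and z: "exponentiable n z" "one_plus_ad n z \<in> carrier (G_group n)"
  shows "one_plus_ad n (lstar_prod n y z) \<in> x_closure"
proof -
  interpret GL: group "GL_Lstar n" by (rule group_GL)
  interpret G: group "G_group n" by (rule group_G)
  interpret N: normal x_closure "G_group n" by (rule normal_x_closure)
  have "inv\<^bsub>G_group n\<^esub> (one_plus_ad n z) = one_plus_ad n z"
    using z by (intro G.inv_equality) (simp_all add: one_plus_ad_square)
  then have "one_plus_ad n z \<otimes>\<^bsub>GL_Lstar n\<^esub> one_plus_ad n y \<otimes>\<^bsub>GL_Lstar n\<^esub> one_plus_ad n z \<in> x_closure"
    using N.inv_op_closed1[OF z(2) y(2)] by simp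
  then have "one_plus_ad n y \<otimes>\<^bsub>GL_Lstar n\<^esub> (one_plus_ad n z \<otimes>\<^bsub>GL_Lstar n\<^esub> one_plus_ad n y
      \<otimes>\<^bsub>GL_Lstar n\<^esub> one_plus_ad n z) \<in> x_closure"
    using N.m_closed[OF y(2)] by simp
  then show ?thesis
    using commutator_one_plus_ad[OF y(1) z(1)] y z by (simp add: GL.m_assoc)
qed

lemma witt_index_infinite: "infinite A \<Longrightarrow> a \<le> n \<Longrightarrow> witt_index n A a"
  by (auto simp: witt_index_def)

text \<open>
  Multiplication by \<open>w = f\<^sub>0\<close> lowers the index by one, starting from \<open>x = f\<^sub>n\<^sub>+\<^sub>1\<close>. Each step consumes one half
  of the label, and an infinite label never runs out.
\<close>
lemma x_closure_witt_elem:
  assumes "a \<le> n" "infinite A"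
  shows "one_plus_ad n (witt_elem n A a) \<in> x_closure"
  using assms
proof (induction arbitrary: A rule: inc_induct)
  case base
  then have A: "A \<noteq> {}" by auto
  have "lstar_prod n xstar (wwstar A) = witt_elem n A n"
    using witt_elem_xstar[of A 0] A lstar_prod_commute[of xstar "witt_elem n A 0"]
      exponentiable_xstar
    by (simp add: wwstar_eq witt_index_def)
  then show ?case
    using x_closure_prod[OF exponentiable_xstar x_closure_xstar exponentiable_wwstar
        one_plus_ad_wwstar_G[of A]] by simp
next
  case (step a)
  obtain B C where BC: "infinite B" "infinite C" "B \<inter> C = {}" "B \<union> C = A"
    using infinite_halves[OF step.prems] by blast
  have B: "witt_index n B (Suc a)" and C: "witt_index n C 0" and "C \<noteq> {}"
    using BC step.hyps by (auto intro: witt_index_infinite)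
  have "lstar_prod n (witt_elem n B (Suc a)) (wwstar C) = witt_elem n A a"
    using lstar_prod_witt_elem[OF B C] BC \<open>C \<noteq> {}\<close>
    by (simp add: wwstar_eq smul_of_nat witt_coeff_def)
  then show ?case
    using x_closure_prod[OF exponentiable_witt_elem[OF B] step.IH[OF BC(1)] exponentiable_wwstar
        one_plus_ad_wwstar_G[of C]] by simp
qed

abbreviation "x_closure_group \<equiv> (G_group n)\<lparr>carrier := x_closure\<rparr>"

lemma group_x_closure: "group x_closure_group"
  using subgroup.subgroup_is_group[OF normal_imp_subgroup[OF normal_x_closure] group_G] .

text \<open>
  The relation \<open>f\<^sub>0 \<cdot> f\<^sub>1 = f\<^sub>0\<close>, with the label \<open>A\<close> split into two infinite halves, expresses
  \<open>1 + ad((f\<^sub>0)\<^sub>A)\<close> as a commutator of an element of the same kind with an element of the closure.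
\<close>
lemma lower_central_witt_elem:
  assumes "infinite A"
  shows "one_plus_ad n (witt_elem n A 0) \<in> lower_central x_closure_group k"
  using assms
proof (induction k arbitrary: A)
  case 0
  then show ?case using x_closure_witt_elem[of 0 A] by simp
next
  case (Suc k)
  interpret H: group x_closure_group by (rule group_x_closure)
  obtain B C where BC: "infinite B" "infinite C" "B \<inter> C = {}" "B \<union> C = A"
    using infinite_halves[OF Suc.prems] by blast
  have n1: "1 \<le> n" using two_le_n by simp
  let ?b = "one_plus_ad n (witt_elem n B 0)" and ?c = "one_plus_ad n (witt_elem n C 1)"
  have B: "witt_index n B 0" and C: "witt_index n C 1"
    using BC n1 by (auto intro: witt_index_infinite)
  note eB = exponentiable_witt_elem[OF B] and eC = exponentiable_witt_elem[OF C]
  have bH: "?b \<in> carrier x_closure_group" and cH: "?c \<in> carrier x_closure_group"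
    using x_closure_witt_elem BC n1 by simp_all
  have "commutator x_closure_group ?b ?c
      = ?b \<otimes>\<^bsub>GL_Lstar n\<^esub> ?c \<otimes>\<^bsub>GL_Lstar n\<^esub> ?b \<otimes>\<^bsub>GL_Lstar n\<^esub> ?c"
    using H.commutator_involutions[OF bH cH] one_plus_ad_square[OF eB] one_plus_ad_square[OF eC]
    by simp
  also have "\<dots> = one_plus_ad n (lstar_prod n (witt_elem n B 0) (witt_elem n C 1))"
    by (rule commutator_one_plus_ad[OF eB eC])
  also have "lstar_prod n (witt_elem n B 0) (witt_elem n C 1) = witt_elem n A 0"
    using lstar_prod_witt_elem[OF B C] BC by (simp add: smul_of_nat witt_coeff_def)
  finally have "one_plus_ad n (witt_elem n A 0) = commutator x_closure_group ?b ?c" ..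
  then have "one_plus_ad n (witt_elem n A 0) \<in> {commutator x_closure_group a b |a b.
      a \<in> lower_central x_closure_group k \<and> b \<in> carrier x_closure_group}"
    using Suc.IH[OF BC(1)] cH by blast
  then show ?case by (simp only: lower_central.simps generate.incl)
qed

lemma one_plus_ad_witt_elem_ne_one:
  assumes "infinite A"
  shows "one_plus_ad n (witt_elem n A 0) \<noteq> \<one>\<^bsub>GL_Lstar n\<^esub>"
proof
  assume *: "one_plus_ad n (witt_elem n A 0) = \<one>\<^bsub>GL_Lstar n\<^esub>"
  have A: "A \<noteq> {}" "witt_index n A 0" using assms by (auto intro: witt_index_infinite)
  have x: "xstar \<in> Lstar n" using exponentiable_xstar by simp
  have "xstar + lstar_prod n xstar (witt_elem n A 0) = xstar"
    using fun_cong[OF *, of xstar] x by (simp add: one_plus_ad_apply GL_one)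
  then have "lstar_prod n xstar (witt_elem n A 0) = 0" by simp
  then have "witt_elem n A n = 0"
    using witt_elem_xstar[OF A(2)] lstar_prod_commute[of xstar "witt_elem n A 0"] x A(2) by simp
  then have "Poly_Mapping.single A (Poly_Mapping.single (witt_basis n n) (1 :: bit)) = 0"
    using A(1) by (simp add: witt_elem_def zero_prod_def)
  then show False by (metis lookup_single_eq lookup_zero one_neq_zero)
qed

lemma x_closure_not_nilpotent: "\<not> nilpotent_group x_closure_group"
proof
  assume "nilpotent_group x_closure_group"
  then obtain k where k: "lower_central x_closure_group k = {\<one>\<^bsub>GL_Lstar n\<^esub>}"
    by (auto simp: nilpotent_group_def)
  have inf: "infinite (UNIV :: nat set)" by simp
  show False
    using lower_central_witt_elem[OF inf, of k] one_plus_ad_witt_elem_ne_one[OF inf] k by simp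
qed

end

theorem theorem3p4:
  fixes m n :: nat
  assumes "m \<ge> 2" and "n = 2 ^ m - 2"
  shows "left_3_engel (G_group n) (one_plus_ad n xstar) \<and>
    \<not> nilpotent_group
        ((G_group n)\<lparr>carrier := normal_closure (G_group n) {one_plus_ad n xstar}\<rparr>)"
proof -
  interpret witt_parameters m n by unfold_locales (use assms in auto)
  show ?thesis
    using left_3_engel_one_plus_ad_xstar x_closure_not_nilpotent by (simp add: x_closure_def)
qed

end
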